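(* For every DAG $\vec H$ with $k$ vertices, $\mathrm{dtw}(\vec H)\le \frac{k}{5}+4$.
   Context: For a DAG $\vec H$, a source is a vertex of in-degree $0$; $S$ denotes the set of sources; $R(s)$ is the set of vertices reachable from $s$, and $R(B)=\bigcup_{s\in B}R(s)$. A DAG tree decomposition of $\vec H$ is a tree $T$ whose nodes (bags) are subsets of $S$ such that every source lies in some bag and, for any bags $B,B_1,B_2$ with $B$ on the path between $B_1$ and $B_2$ in $T$, $R(B_1)\cap R(B_2)\subseteq R(B)$; its width is the maximum bag size and $\mathrm{dtw}(\vec H)$ is the minimum width. *)

theory Defs
  imports Complex_Main
begin

definition is_dag :: "'a set \<Rightarrow> ('a \<times> 'a) set \<Rightarrow> bool" where
  "is_dag V E \<longleftrightarrow> finite V \<and> E \<subseteq> V \<times> V \<and> acyclic E"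

definition sources :: "'a set \<Rightarrow> ('a \<times> 'a) set \<Rightarrow> 'a set" where
  "sources V E = {v \<in> V. \<forall>u. (u, v) \<notin> E}"

definition reach :: "('a \<times> 'a) set \<Rightarrow> 'a \<Rightarrow> 'a set" where
  "reach E s = {v. (s, v) \<in> E\<^sup>*}"

definition reach_set :: "('a \<times> 'a) set \<Rightarrow> 'a set \<Rightarrow> 'a set" where
  "reach_set E B = (\<Union>s\<in>B. reach E s)"

definition simple_path :: "nat set \<Rightarrow> (nat \<times> nat) set \<Rightarrow> nat list \<Rightarrow> nat \<Rightarrow> nat \<Rightarrow> bool" where
  "simple_path N TE p u v \<longleftrightarrow> p \<noteq> [] \<and> hd p = u \<and> last p = v \<and> distinct p \<and> set p \<subseteq> N \<and>
     (\<forall>i. Suc i < length p \<longrightarrow> (p ! i, p ! Suc i) \<in> TE)"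

definition is_tree :: "nat set \<Rightarrow> (nat \<times> nat) set \<Rightarrow> bool" where
  "is_tree N TE \<longleftrightarrow> finite N \<and> N \<noteq> {} \<and> TE \<subseteq> N \<times> N \<and> sym TE \<and> irrefl TE \<and>
     (\<forall>u\<in>N. \<forall>v\<in>N. \<exists>!p. simple_path N TE p u v)"

definition dag_tree_decomp ::
  "'a set \<Rightarrow> ('a \<times> 'a) set \<Rightarrow> nat set \<Rightarrow> (nat \<times> nat) set \<Rightarrow> (nat \<Rightarrow> 'a set) \<Rightarrow> bool" where
  "dag_tree_decomp V E N TE bag \<longleftrightarrow>
     is_tree N TE \<and>
     (\<forall>t\<in>N. bag t \<subseteq> sources V E) \<and>
     (\<forall>s\<in>sources V E. \<exists>t\<in>N. s \<in> bag t) \<and>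
     (\<forall>t1\<in>N. \<forall>t2\<in>N. \<forall>p. simple_path N TE p t1 t2 \<longrightarrow>
        (\<forall>t\<in>set p. reach_set E (bag t1) \<inter> reach_set E (bag t2) \<subseteq> reach_set E (bag t)))"

definition dtd_width :: "nat set \<Rightarrow> (nat \<Rightarrow> 'a set) \<Rightarrow> nat" where
  "dtd_width N bag = Max ((\<lambda>t. card (bag t)) ` N)"

definition dtw :: "'a set \<Rightarrow> ('a \<times> 'a) set \<Rightarrow> nat" where
  "dtw V E = (LEAST w. \<exists>N TE bag. dag_tree_decomp V E N TE bag \<and> dtd_width N bag = w)"

end

(* Only the set system of non-sources reached by each source matters. Putting a source into every bag
   deletes it together with everything it reaches; if what remains is an alpha-acyclic hypergraph, a
   join tree of it gives bags with one further source, so dtw is at most k/5 + 1 once five vertices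
   are deleted per chosen source. Deletions that cost nothing are the GYO reductions: an ear (a source
   whose overlap with the other sources lies in one of them) or an element of degree at most one.
   A source with four residual elements deletes five vertices by itself. If all residual sets have
   size three, a choice deletes only four, but it leaves a residual set of size at most two, and the
   presence of such a set among sets of size at most three is a credit of one that later choices
   preserve: a source of size three meeting one of size two turns the latter into an ear, and a source
   of size two isolated from those of size three turns two neighbours into ears. *)

theory Submission
  imports Defs
begin

section \<open>Simple paths, and trees grown by attaching a leaf\<close>

lemma simple_path_iff:
  "simple_path N TE p u v \<longleftrightarrow> p \<noteq> [] \<and> hd p = u \<and> last p = v \<and> distinct p \<and> set p \<subseteq> N \<and>
     successively (\<lambda>x y. (x, y) \<in> TE) p"
  by (auto simp: simple_path_def successively_conv_nth)

lemma simple_path_refl_iff: "simple_path N TE p u u \<longleftrightarrow> u \<in> N \<and> p = [u]"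
proof
  assume p: "simple_path N TE p u u"
  show "u \<in> N \<and> p = [u]"
  proof (cases p)
    case (Cons a q)
    then show ?thesis using p by (cases "q = []") (auto simp: simple_path_iff)
  qed (use p in \<open>auto simp: simple_path_iff\<close>)
qed (auto simp: simple_path_iff)

lemma simple_path_rev:
  assumes "sym TE"
  shows "simple_path N TE (rev p) v u \<longleftrightarrow> simple_path N TE p u v"
proof -
  have "successively (\<lambda>x y. (y, x) \<in> TE) p \<longleftrightarrow> successively (\<lambda>x y. (x, y) \<in> TE) p"
    using assms by (intro successively_cong) (auto simp: sym_def)
  then show ?thesis
    by (auto simp: simple_path_iff hd_rev last_rev)
qed

definition add_leaf :: "nat \<Rightarrow> nat \<Rightarrow> (nat \<times> nat) set \<Rightarrow> (nat \<times> nat) set" where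
  "add_leaf u v TE = TE \<union> {(u, v), (v, u)}"

context
  fixes N :: "nat set" and TE :: "(nat \<times> nat) set" and u v :: nat
  assumes tree: "is_tree N TE" and u: "u \<in> N" and v: "v \<notin> N"
begin

lemma sym_add_leaf: "sym (add_leaf u v TE)"
  using tree by (auto simp: is_tree_def add_leaf_def sym_def)

lemma add_leaf_avoid:
  assumes "v \<notin> set p"
  shows "simple_path (insert v N) (add_leaf u v TE) p a b \<longleftrightarrow> simple_path N TE p a b"
proof -
  have "successively (\<lambda>x y. (x, y) \<in> add_leaf u v TE) p \<longleftrightarrow> successively (\<lambda>x y. (x, y) \<in> TE) p"
    by (rule successively_cong) (use assms in \<open>auto simp: add_leaf_def\<close>)
  then show ?thesis using assms by (auto simp: simple_path_iff)
qed

lemma add_leaf_edge: "(v, x) \<in> add_leaf u v TE \<longleftrightarrow> x = u" "(x, v) \<in> add_leaf u v TE \<longleftrightarrow> x = u"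
  using tree u v by (auto simp: is_tree_def add_leaf_def)

text \<open>The only neighbour of \<open>v\<close> is \<open>u\<close>, so a path passing through
  \<open>v\<close> would visit \<open>u\<close> both before and after it, against
  distinctness.\<close>

lemma add_leaf_not_interior:
  assumes p: "simple_path (insert v N) (add_leaf u v TE) p a b" and "a \<noteq> v" "b \<noteq> v"
  shows "v \<notin> set p"
proof
  assume "v \<in> set p"
  then obtain xs ys where pp: "p = xs @ v # ys" by (meson split_list)
  have ne: "xs \<noteq> []" "ys \<noteq> []"
    using p pp assms(2,3) by (auto simp: simple_path_iff)
  have "(last xs, v) \<in> add_leaf u v TE" "(v, hd ys) \<in> add_leaf u v TE"
    using p pp ne by (auto simp: simple_path_iff successively_append_iff successively_Cons)
  then have "last xs = hd ys" by (simp add: add_leaf_edge)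
  then have "last xs \<in> set xs \<inter> set ys" using ne by (metis IntI hd_in_set last_in_set)
  then show False using p pp by (auto simp: simple_path_iff)
qed

text \<open>The first step out of \<open>v\<close> must go to \<open>u\<close>; distinctness keeps
  the rest away from \<open>v\<close>, so the rest is a path of the old tree.\<close>

lemma add_leaf_from:
  assumes "b \<in> N"
  shows "simple_path (insert v N) (add_leaf u v TE) p v b \<longleftrightarrow> (\<exists>q. p = v # q \<and> simple_path N TE q u b)"
proof
  assume p: "simple_path (insert v N) (add_leaf u v TE) p v b"
  then obtain q where q: "p = v # q" by (cases p) (auto simp: simple_path_iff)
  have ne: "q \<noteq> []" using p q assms v by (auto simp: simple_path_iff)
  have "hd q = u" "v \<notin> set q"
    using p q ne by (auto simp: simple_path_iff successively_Cons add_leaf_edge)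
  moreover have "simple_path (insert v N) (add_leaf u v TE) q (hd q) b"
    using p q ne by (auto simp: simple_path_iff successively_Cons)
  ultimately have "simple_path N TE q u b" using add_leaf_avoid by simp
  then show "\<exists>q. p = v # q \<and> simple_path N TE q u b" using q by blast
next
  assume "\<exists>q. p = v # q \<and> simple_path N TE q u b"
  then obtain q where q: "p = v # q" "simple_path N TE q u b" by blast
  then have vq: "v \<notin> set q" using v by (auto simp: simple_path_iff)
  then have "simple_path (insert v N) (add_leaf u v TE) q u b" using q add_leaf_avoid by simp
  then show "simple_path (insert v N) (add_leaf u v TE) p v b"
    using q(1) vq by (auto simp: simple_path_iff successively_Cons add_leaf_edge)
qed

lemma add_leaf_to:
  assumes "a \<in> N"
  shows "simple_path (insert v N) (add_leaf u v TE) p a v \<longleftrightarrow> (\<exists>q. rev p = v # q \<and> simple_path N TE q u a)"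
  using add_leaf_from[OF assms, of "rev p"] simple_path_rev[OF sym_add_leaf, of "insert v N" p v a]
  by simp

lemma add_leaf_old:
  assumes "a \<in> N" "b \<in> N"
  shows "simple_path (insert v N) (add_leaf u v TE) p a b \<longleftrightarrow> simple_path N TE p a b"
proof -
  have "v \<notin> set p" if "simple_path (insert v N) (add_leaf u v TE) p a b"
    using add_leaf_not_interior[OF that] assms v by metis
  moreover have "v \<notin> set p" if "simple_path N TE p a b"
    using that v by (auto simp: simple_path_iff)
  ultimately show ?thesis using add_leaf_avoid by blast
qed

text \<open>Uniqueness is inherited: paths between old nodes are the old ones, and a path with one
  end at \<open>v\<close> is determined by the unique old path from \<open>u\<close> to its other
  end.\<close>

lemma is_tree_add_leaf: "is_tree (insert v N) (add_leaf u v TE)"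
proof -
  have ex1: "\<exists>!p. simple_path N TE p a b" if "a \<in> N" "b \<in> N" for a b
    using tree that unfolding is_tree_def by blast
  have "\<exists>!p. simple_path (insert v N) (add_leaf u v TE) p a b"
    if ab: "a \<in> insert v N" "b \<in> insert v N" for a b
  proof -
    consider "a \<in> N" "b \<in> N" | "a = v" "b = v" | "a = v" "b \<in> N" | "a \<in> N" "b = v"
      using ab by blast
    then show ?thesis
    proof cases
      case 1
      then show ?thesis using ex1 add_leaf_old by simp
    next
      case 2
      then show ?thesis by (simp add: simple_path_refl_iff)
    next
      case 3
      then show ?thesis using ex1[OF u 3(2)] by (auto simp: add_leaf_from)
    next
      case 4
      obtain q where q: "simple_path N TE q u a" "\<And>q'. simple_path N TE q' u a \<Longrightarrow> q' = q"
        using ex1[OF u 4(1)] by blast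
      show ?thesis
      proof (rule ex1I)
        show "simple_path (insert v N) (add_leaf u v TE) (rev (v # q)) a b"
          unfolding 4(2) add_leaf_to[OF 4(1)] using q(1) by simp
      next
        fix p assume "simple_path (insert v N) (add_leaf u v TE) p a b"
        then have "rev p = v # q"
          unfolding 4(2) add_leaf_to[OF 4(1)] using q(2) by blast
        then show "p = rev (v # q)" by (metis rev_rev_ident)
      qed
    qed
  qed
  moreover have "irrefl (add_leaf u v TE)"
    using tree u v by (auto simp: is_tree_def add_leaf_def irrefl_def)
  ultimately show ?thesis
    using tree u sym_add_leaf by (auto simp: is_tree_def add_leaf_def)
qed

end

lemma is_tree_singleton: "is_tree {n} {}"
  by (auto simp: is_tree_def simple_path_refl_iff sym_def irrefl_def)

section \<open>Bags connected along tree paths, and join trees\<close>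

definition connected_bags :: "nat set \<Rightarrow> (nat \<times> nat) set \<Rightarrow> (nat \<Rightarrow> 'x set) \<Rightarrow> bool" where
  "connected_bags T TE C \<longleftrightarrow>
     (\<forall>t1\<in>T. \<forall>t2\<in>T. \<forall>p. simple_path T TE p t1 t2 \<longrightarrow> (\<forall>t\<in>set p. C t1 \<inter> C t2 \<subseteq> C t))"

text \<open>A path out of \<open>v\<close> continues from \<open>u\<close>. Whatever the new bag
  shares with an old bag lies in \<open>C u\<close>, and the old condition carries it along the rest
  of the path.\<close>

lemma connected_bags_add_leaf:
  assumes tree: "is_tree T TE" and u: "u \<in> T" and v: "v \<notin> T"
    and C: "connected_bags T TE C"
    and C': "\<And>t. t \<in> T \<Longrightarrow> C' t = C t" and sub: "\<And>t. t \<in> T \<Longrightarrow> C' v \<inter> C t \<subseteq> C u"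
  shows "connected_bags (insert v T) (add_leaf u v TE) C'"
  unfolding connected_bags_def
proof (intro ballI allI impI)
  fix a b p t
  assume ab: "a \<in> insert v T" "b \<in> insert v T"
    and p: "simple_path (insert v T) (add_leaf u v TE) p a b" and t: "t \<in> set p"
  have old: "C a \<inter> C b \<subseteq> C t" "t \<in> T" if "simple_path T TE q a b" "a \<in> T" "b \<in> T" "t \<in> set q" for q a b t
    using C that unfolding connected_bags_def simple_path_iff by blast+
  have leaf: "C' v \<inter> C' c \<subseteq> C' t" if "simple_path T TE q u c" "c \<in> T" "t \<in> set (v # q)" for q c
  proof (cases "t = v")
    case False
    then have tq: "t \<in> set q" using that by simp
    note o = old[OF that(1) u that(2) tq]
    show ?thesis using o sub[OF that(2)] C'[OF that(2)] C'[OF o(2)] by blast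
  qed blast
  consider "a \<in> T" "b \<in> T" | "a = v" "b = v" | "a = v" "b \<in> T" | "a \<in> T" "b = v"
    using ab by blast
  then show "C' a \<inter> C' b \<subseteq> C' t"
  proof cases
    case 1
    then have q: "simple_path T TE p a b" using p add_leaf_old[OF tree u v] by blast
    show ?thesis using old[OF q 1 t] C' 1 by simp
  next
    case 2
    then show ?thesis using p t by (auto simp: simple_path_refl_iff)
  next
    case 3
    then obtain q where "p = v # q" "simple_path T TE q u b"
      using p add_leaf_from[OF tree u v] by blast
    then show ?thesis using leaf 3 t by blast
  next
    case 4
    then obtain q where q: "rev p = v # q" "simple_path T TE q u a"
      using p add_leaf_to[OF tree u v] by blast
    have "t \<in> set (v # q)" using t q(1) by (metis set_rev)
    then show ?thesis using leaf[OF q(2) 4(1)] 4(2) by blast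
  qed
qed

text \<open>A join tree of the hypergraph with edges \<open>R s \<inter> X\<close>. Injectivity of
  \<open>b\<close> gives every source exactly one node; the empty system is a separate case because
  a tree has a node.\<close>

definition join_tree :: "('s \<Rightarrow> 'x set) \<Rightarrow> 's set \<Rightarrow> 'x set \<Rightarrow> bool" where
  "join_tree R S X \<longleftrightarrow> S = {} \<or> (\<exists>T TE b. is_tree T TE \<and> connected_bags T TE (\<lambda>t. R (b t) \<inter> X) \<and>
     inj_on b T \<and> b ` T = S)"

text \<open>The ear \<open>s\<close> is hung as a leaf on the node of the source that absorbs its
  overlaps.\<close>

lemma join_tree_insert:
  assumes J: "join_tree R S X" and s: "s \<notin> S"
    and ear: "S = {} \<or> (\<exists>s'\<in>S. \<forall>t\<in>S. R s \<inter> R t \<inter> X \<subseteq> R s')"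
  shows "join_tree R (insert s S) X"
proof (cases "S = {}")
  case True
  have "connected_bags {0} {} (\<lambda>t. R s \<inter> X)" by (auto simp: connected_bags_def)
  then show ?thesis using True is_tree_singleton[of 0] unfolding join_tree_def
    by (intro disjI2 exI[of _ "{0}"] exI[of _ "{}"] exI[of _ "\<lambda>_. s"]) auto
next
  case False
  then obtain T TE b where T: "is_tree T TE" "connected_bags T TE (\<lambda>t. R (b t) \<inter> X)"
      "inj_on b T" "b ` T = S"
    using J unfolding join_tree_def by auto
  obtain u where u: "u \<in> T" "\<forall>t\<in>S. R s \<inter> R t \<inter> X \<subseteq> R (b u)" using ear False T(4) by auto
  obtain v where v: "v \<notin> T" using T(1) ex_new_if_finite[of T] unfolding is_tree_def by auto
  define b' where "b' = b(v := s)"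
  have "connected_bags (insert v T) (add_leaf u v TE) (\<lambda>t. R (b' t) \<inter> X)"
    by (rule connected_bags_add_leaf[OF T(1) u(1) v T(2)]) (use u v T(4) in \<open>auto simp: b'_def\<close>)
  moreover have "inj_on b' (insert v T)" "b' ` insert v T = insert s S"
    using T(3,4) v s by (auto simp: b'_def inj_on_def)
  ultimately show ?thesis
    using is_tree_add_leaf[OF T(1) u(1) v] unfolding join_tree_def by blast
qed

text \<open>If \<open>x\<close> lies in both end bags of a path, the two ends carry the same source,
  hence are the same node, and the path is trivial.\<close>

lemma join_tree_insert_element:
  assumes J: "join_tree R S (X - {x})"
    and deg: "\<And>s t. s \<in> S \<Longrightarrow> t \<in> S \<Longrightarrow> x \<in> R s \<Longrightarrow> x \<in> R t \<Longrightarrow> s = t"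
  shows "join_tree R S X"
proof (cases "S = {}")
  case False
  then obtain T TE b where T: "is_tree T TE" "connected_bags T TE (\<lambda>t. R (b t) \<inter> (X - {x}))"
      "inj_on b T" "b ` T = S"
    using J unfolding join_tree_def by auto
  have "connected_bags T TE (\<lambda>t. R (b t) \<inter> X)"
    unfolding connected_bags_def
  proof (intro ballI allI impI subsetI)
    fix t1 t2 p t y
    assume t: "t1 \<in> T" "t2 \<in> T" "simple_path T TE p t1 t2" "t \<in> set p"
      and y: "y \<in> R (b t1) \<inter> X \<inter> (R (b t2) \<inter> X)"
    show "y \<in> R (b t) \<inter> X"
    proof (cases "y = x")
      case True
      then have "b t1 = b t2" using deg T(4) t y by blast
      then have "t1 = t2" using T(3) t by (auto simp: inj_on_def)
      then show ?thesis using t y by (auto simp: simple_path_refl_iff)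
    next
      case False
      then show ?thesis using T(2) t y unfolding connected_bags_def by blast
    qed
  qed
  then show ?thesis using T unfolding join_tree_def by blast
qed (simp add: join_tree_def)

section \<open>Ears, and systems that become acyclic once some sources are chosen\<close>

definition ear :: "('s \<Rightarrow> 'x set) \<Rightarrow> 's set \<Rightarrow> 'x set \<Rightarrow> 's \<Rightarrow> bool" where
  "ear R S X s \<longleftrightarrow> S = {s} \<or> (\<exists>s'\<in>S - {s}. \<forall>t\<in>S - {s}. R s \<inter> R t \<inter> X \<subseteq> R s')"

lemma ear_if_dominated: "s' \<in> S - {s} \<Longrightarrow> R s \<inter> X \<subseteq> R s' \<Longrightarrow> ear R S X s"
  unfolding ear_def by blast

text \<open>At most one element remains: either another source has it and dominates
  \<open>s\<close>, or every overlap of \<open>s\<close> is empty and any other source can serve as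
  witness.\<close>

lemma ear_if_small:
  assumes "s \<in> S" "finite X" "card (R s \<inter> X) \<le> 1"
  shows "ear R S X s"
proof (cases "\<exists>t\<in>S - {s}. R s \<inter> R t \<inter> X \<noteq> {}")
  case True
  then obtain t x where t: "t \<in> S - {s}" "x \<in> R s \<inter> X" "x \<in> R t" by blast
  then have "R s \<inter> X = {x}" using assms(2,3) by (auto simp: card_le_Suc0_iff_eq)
  then show ?thesis using t by (intro ear_if_dominated[of t]) auto
next
  case False
  then show ?thesis using assms(1) unfolding ear_def by blast
qed

text \<open>\<open>B\<close> holds the chosen sources, destined for every bag; the join tree
  concerns only the sources and elements they leave over.\<close>

definition acyclic_after :: "('s \<Rightarrow> 'x set) \<Rightarrow> 's set \<Rightarrow> 'x set \<Rightarrow> nat \<Rightarrow> bool" where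
  "acyclic_after R S X w \<longleftrightarrow> (\<exists>B\<subseteq>S. card B \<le> w \<and> join_tree R (S - B) (X - \<Union>(R ` B)))"

lemma acyclic_after_empty: "acyclic_after R {} X 0"
  by (simp add: acyclic_after_def join_tree_def)

text \<open>The point is that an ear of the full system is still an ear after the deletion of
  \<open>B\<close> and of all it reaches.\<close>

lemma acyclic_after_remove_source:
  assumes F: "acyclic_after R (S - {s}) X w" and s: "s \<in> S"
    and e: "ear R S X s"
  shows "acyclic_after R S X w"
proof -
  obtain B where B: "B \<subseteq> S - {s}" "card B \<le> w" "join_tree R (S - {s} - B) (X - \<Union>(R ` B))"
    using F unfolding acyclic_after_def by blast
  have "join_tree R (insert s (S - {s} - B)) (X - \<Union>(R ` B))"
  proof (rule join_tree_insert[OF B(3)])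
    show "S - {s} - B = {} \<or>
        (\<exists>s'\<in>S - {s} - B. \<forall>t\<in>S - {s} - B. R s \<inter> R t \<inter> (X - \<Union>(R ` B)) \<subseteq> R s')"
    proof (cases "S = {s}")
      case False
      then obtain s' where s': "s' \<in> S - {s}" "\<And>t. t \<in> S - {s} \<Longrightarrow> R s \<inter> R t \<inter> X \<subseteq> R s'"
        using e unfolding ear_def by blast
      show ?thesis
      proof (cases "s' \<in> B")
        case True
        \<comment> \<open>The overlaps of \<open>s\<close> lie in \<open>R s'\<close>, which is
          deleted with \<open>B\<close>; none survives, so any remaining source is a
          witness.\<close>
        then have "R s \<inter> R t \<inter> (X - \<Union>(R ` B)) = {}" if "t \<in> S - {s}" for t
          using s'(2)[OF that] by blast
        then show ?thesis by fastforce
      next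
        case False
        then show ?thesis using s' by blast
      qed
    qed blast
  qed simp
  moreover have "insert s (S - {s} - B) = S - B" using B(1) s by blast
  ultimately show ?thesis using B unfolding acyclic_after_def by (metis Diff_subset subset_trans)
qed

lemma acyclic_after_remove_element:
  assumes F: "acyclic_after R S (X - {x}) w"
    and deg: "\<And>s t. s \<in> S \<Longrightarrow> t \<in> S \<Longrightarrow> x \<in> R s \<Longrightarrow> x \<in> R t \<Longrightarrow> s = t"
  shows "acyclic_after R S X w"
proof -
  obtain B where B: "B \<subseteq> S" "card B \<le> w" "join_tree R (S - B) (X - {x} - \<Union>(R ` B))"
    using F unfolding acyclic_after_def by blast
  have "X - {x} - \<Union>(R ` B) = X - \<Union>(R ` B) - {x}" by blast
  then have "join_tree R (S - B) (X - \<Union>(R ` B))"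
    using join_tree_insert_element[of R "S - B" "X - \<Union>(R ` B)" x] B(3) deg by auto
  then show ?thesis using B unfolding acyclic_after_def by blast
qed

lemma acyclic_after_choose:
  assumes F: "acyclic_after R (S - {s}) (X - R s) w" and s: "s \<in> S" and fin: "finite S"
  shows "acyclic_after R S X (Suc w)"
proof -
  obtain B where B: "B \<subseteq> S - {s}" "card B \<le> w" "join_tree R (S - {s} - B) (X - R s - \<Union>(R ` B))"
    using F unfolding acyclic_after_def by blast
  have "finite B" "s \<notin> B" using B(1) fin by (auto intro: finite_subset)
  then have "card (insert s B) \<le> Suc w" using B(2) by simp
  moreover have "S - {s} - B = S - insert s B" "X - R s - \<Union>(R ` B) = X - \<Union>(R ` insert s B)" by auto
  ultimately show ?thesis
    using B s unfolding acyclic_after_def by (intro exI[of _ "insert s B"]) auto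
qed

section \<open>Irreducible systems, the credit and the counting induction\<close>

definition reducible :: "('s \<Rightarrow> 'x set) \<Rightarrow> 's set \<Rightarrow> 'x set \<Rightarrow> bool" where
  "reducible R S X \<longleftrightarrow> (\<exists>s\<in>S. ear R S X s) \<or>
     (\<exists>x\<in>X. \<forall>s\<in>S. \<forall>t\<in>S. x \<in> R s \<longrightarrow> x \<in> R t \<longrightarrow> s = t)"

text \<open>Reducibility is included because a reduction removes a vertex without a choice and so
  saves one vertex by itself.\<close>

definition credit :: "('s \<Rightarrow> 'x set) \<Rightarrow> 's set \<Rightarrow> 'x set \<Rightarrow> bool" where
  "credit R S X \<longleftrightarrow> reducible R S X \<or>
     (\<forall>s\<in>S. card (R s \<inter> X) \<le> 3) \<and> (\<exists>s\<in>S. card (R s \<inter> X) \<le> 2)"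

text \<open>Each failure would be a free reduction: an element of degree one, an ear by smallness,
  or an ear by domination.\<close>

lemma irreducible_source:
  assumes nr: "\<not> reducible R S X" and s: "s \<in> S" and fin: "finite X"
  shows "\<And>x. x \<in> R s \<inter> X \<Longrightarrow> \<exists>t\<in>S - {s}. x \<in> R t"
    and "card (R s \<inter> X) \<ge> 2" and "\<And>t. t \<in> S - {s} \<Longrightarrow> \<not> R s \<inter> X \<subseteq> R t"
proof -
  show "\<exists>t\<in>S - {s}. x \<in> R t" if "x \<in> R s \<inter> X" for x
    using nr that unfolding reducible_def by blast
  show "\<not> R s \<inter> X \<subseteq> R t" if "t \<in> S - {s}" for t
    using nr s ear_if_dominated[OF that] unfolding reducible_def by blast
  show "card (R s \<inter> X) \<ge> 2"
    using nr s ear_if_small[OF s fin, of R] unfolding reducible_def by force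
qed

text \<open>Sizes can only shrink, and the surviving \<open>t\<close> loses \<open>b\<close>,
  dropping from at most three to at most two.\<close>

lemma credit_after_choose:
  assumes fin: "finite X" and le3: "\<And>s. s \<in> S \<Longrightarrow> card (R s \<inter> X) \<le> 3"
    and S': "S' \<subseteq> S" and t: "t \<in> S'" "b \<in> R t \<inter> X" "b \<notin> X'" and X': "X' \<subseteq> X"
  shows "credit R S' X'"
proof -
  have "card (R r \<inter> X') \<le> 3" if "r \<in> S'" for r
  proof -
    have "card (R r \<inter> X') \<le> card (R r \<inter> X)" by (rule card_mono) (use fin X' in auto)
    then show ?thesis using le3[of r] S' that by fastforce
  qed
  moreover have "card (R t \<inter> X') < card (R t \<inter> X)"
    by (rule psubset_card_mono) (use fin X' t in auto)
  then have "card (R t \<inter> X') \<le> 2" using le3[of t] t S' by fastforce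
  ultimately show ?thesis using t unfolding credit_def by blast
qed

text \<open>Induction on the number of vertices. A choice that deletes five vertices, or four while
  leaving a credit, pays for itself; one that deletes five and leaves a credit also preserves the
  sharper bound.\<close>

lemma acyclic_after_fifth:
  assumes "finite S" "finite X"
  shows "\<exists>w. acyclic_after R S X w \<and> 5 * w \<le> card S + card X \<and>
    (credit R S X \<longrightarrow> 5 * w + 1 \<le> card S + card X)"
  using assms
proof (induction "card S + card X" arbitrary: S X rule: less_induct)
  case less
  note fin = less.prems
  have ih: "\<exists>w. acyclic_after R S' X' w \<and> 5 * w \<le> card S' + card X' \<and>
      (credit R S' X' \<longrightarrow> 5 * w + 1 \<le> card S' + card X')"
    if "S' \<subseteq> S" "X' \<subseteq> X" "card S' + card X' < card S + card X" for S' X'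
    by (rule less.hyps) (use that fin in \<open>auto intro: finite_subset\<close>)
  have card_choose: "card (X - R s) + card (R s \<inter> X) = card X" for s
    using card_Int_Diff[of X "R s"] fin by (simp add: Int_commute)
  consider (src) s where "s \<in> S" "ear R S X s"
    | (elt) x where "x \<in> X" "\<forall>s\<in>S. \<forall>t\<in>S. x \<in> R s \<longrightarrow> x \<in> R t \<longrightarrow> s = t"
    | (irr) "\<not> reducible R S X"
    unfolding reducible_def by blast
  then show ?case
  proof cases
    case src
    have c: "card (S - {s}) + 1 = card S" using card_Suc_Diff1[OF fin(1) src(1)] by simp
    obtain w where "acyclic_after R (S - {s}) X w" "5 * w \<le> card (S - {s}) + card X"
      using ih[of "S - {s}" X] c by auto
    then show ?thesis using acyclic_after_remove_source[of R S s X w] src c by force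
  next
    case elt
    have c: "card (X - {x}) + 1 = card X" using card_Suc_Diff1[OF fin(2) elt(1)] by simp
    obtain w where "acyclic_after R S (X - {x}) w" "5 * w \<le> card S + card (X - {x})"
      using ih[of S "X - {x}"] c by auto
    then show ?thesis using acyclic_after_remove_element[of R S X x w] elt c by force
  next
    case irr
    note irrs = irreducible_source[OF irr _ fin(2)]
    show ?thesis
    proof (cases "S = {}")
      case True
      \<comment> \<open>With neither a reduction nor a source there is no credit, so only the plain
        bound is owed and \<open>w = 0\<close> meets it.\<close>
      then have "\<not> credit R S X" using irr by (auto simp: credit_def)
      then show ?thesis using True acyclic_after_empty[of R X] by force
    next
      case False
      \<comment> \<open>Irreducibility makes all sizes at least two. Without a size of four or more,
        either all are three, or some source of size two exists, and then it is decisive whether one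
        of size three meets one of size two.\<close>
      consider (big) s where "s \<in> S" "card (R s \<inter> X) \<ge> 4"
        | (three) "\<And>s. s \<in> S \<Longrightarrow> card (R s \<inter> X) = 3"
        | (meet) s s' where "\<And>s. s \<in> S \<Longrightarrow> card (R s \<inter> X) \<le> 3" "s \<in> S" "s' \<in> S"
            "card (R s \<inter> X) = 3" "card (R s' \<inter> X) = 2" "R s \<inter> R s' \<inter> X \<noteq> {}"
        | (apart) s where "\<And>s. s \<in> S \<Longrightarrow> card (R s \<inter> X) \<le> 3" "s \<in> S" "card (R s \<inter> X) = 2"
            "\<And>s t. s \<in> S \<Longrightarrow> t \<in> S \<Longrightarrow> card (R s \<inter> X) = 2 \<Longrightarrow> R s \<inter> R t \<inter> X \<noteq> {}
              \<Longrightarrow> card (R t \<inter> X) = 2"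
      proof -
        have sizes: "card (R t \<inter> X) \<le> 3 \<Longrightarrow> card (R t \<inter> X) = 2 \<or> card (R t \<inter> X) = 3"
          if "t \<in> S" for t using irrs(2)[OF that] by linarith
        show ?thesis
        proof (cases "\<exists>s\<in>S. card (R s \<inter> X) \<ge> 4")
          case True
          then show ?thesis using big by blast
        next
          case False
          then have le: "card (R s \<inter> X) \<le> 3" if "s \<in> S" for s using that by force
          show ?thesis
          proof (cases "\<exists>s\<in>S. card (R s \<inter> X) = 2")
            case False
            then show ?thesis using three sizes le by blast
          next
            case True
            then obtain s where s: "s \<in> S" "card (R s \<inter> X) = 2" by blast
            show ?thesis
            proof (cases "\<exists>s\<in>S. \<exists>s'\<in>S. card (R s \<inter> X) = 3 \<and> card (R s' \<inter> X) = 2 \<and> R s \<inter> R s' \<inter> X \<noteq> {}")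
              case True
              then show ?thesis using meet le by blast
            next
              case False
              show ?thesis
              proof (rule apart[OF le s])
                fix s t assume "s \<in> S" "t \<in> S" "card (R s \<inter> X) = 2" "R s \<inter> R t \<inter> X \<noteq> {}"
                then show "card (R t \<inter> X) = 2" using False sizes le
                  by (metis inf_commute)
              qed
            qed
          qed
        qed
      qed
      then show ?thesis
      proof cases
        case big
        have c: "card (S - {s}) + 1 = card S" using card_Suc_Diff1[OF fin(1) big(1)] by simp
        obtain w where w: "acyclic_after R (S - {s}) (X - R s) w" "5 * w \<le> card (S - {s}) + card (X - R s)"
          using ih[of "S - {s}" "X - R s"] c card_choose[of s] by auto
        \<comment> \<open>Only the plain bound is owed, and \<open>s\<close> with at least four
          elements deletes five vertices.\<close>
        have "\<not> credit R S X" using irr big unfolding credit_def by force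
        then show ?thesis using acyclic_after_choose[OF w(1) big(1) fin(1)] w(2) c card_choose[of s] big(2)
          by (intro exI[of _ "Suc w"]) auto
      next
        case three
        obtain s where s: "s \<in> S" using False by blast
        have c: "card (S - {s}) + 1 = card S" using card_Suc_Diff1[OF fin(1) s] by simp
        have "R s \<inter> X \<noteq> {}" using three[OF s] by force
        \<comment> \<open>Another source shares \<open>x\<close> and loses it, which creates the
          credit.\<close>
        then obtain x where x: "x \<in> R s \<inter> X" by blast
        then obtain t where t: "t \<in> S - {s}" "x \<in> R t" using irrs(1)[OF s] by blast
        have "credit R (S - {s}) (X - R s)"
          by (rule credit_after_choose[of X S R _ t x]) (use fin three t x in auto)
        then obtain w where w: "acyclic_after R (S - {s}) (X - R s) w"
            "5 * w + 1 \<le> card (S - {s}) + card (X - R s)"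
          using ih[of "S - {s}" "X - R s"] c card_choose[of s] by auto
        \<comment> \<open>No credit is owed here, so four deleted vertices and the one gained from
          the new credit pay for the choice.\<close>
        have "\<not> credit R S X" using irr three unfolding credit_def by force
        then show ?thesis using acyclic_after_choose[OF w(1) s fin(1)] w(2) c card_choose[of s] three[OF s]
          by (intro exI[of _ "Suc w"]) auto
      next
        case meet
        have ne: "s' \<noteq> s" using meet by auto
        \<comment> \<open>Five vertices go: \<open>s\<close>, \<open>s'\<close> and the three
          elements of \<open>s\<close>.\<close>
        have c: "card (S - {s} - {s'}) + 2 = card S"
          using card_Suc_Diff1[OF fin(1) meet(2)] card_Suc_Diff1[of "S - {s}" s'] meet(3) ne fin by simp
        \<comment> \<open>An element \<open>b\<close> outside \<open>R s'\<close> is wanted, so that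
          the second source found at \<open>b\<close> is not the discarded
          \<open>s'\<close>.\<close>
        have "card (R s' \<inter> X) < card (R s \<inter> X)" using meet by simp
        then have "\<not> R s \<inter> X \<subseteq> R s' \<inter> X" using card_mono[of "R s' \<inter> X" "R s \<inter> X"] fin by auto
        then obtain b where b: "b \<in> R s \<inter> X" "b \<notin> R s'" by blast
        \<comment> \<open>\<open>t\<close> survives and loses \<open>b\<close>, so it carries the credit on.\<close>
        then obtain t where t: "t \<in> S - {s}" "b \<in> R t" using irrs(1)[OF meet(2)] by blast
        then have t': "t \<in> S - {s} - {s'}" using b by auto
        have "credit R (S - {s} - {s'}) (X - R s)"
          by (rule credit_after_choose[of X S R _ t b]) (use fin meet(1) t' t b in auto)
        then obtain w where w: "acyclic_after R (S - {s} - {s'}) (X - R s) w"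
            "5 * w + 1 \<le> card (S - {s} - {s'}) + card (X - R s)"
          using ih[of "S - {s} - {s'}" "X - R s"] c card_choose[of s] by auto
        \<comment> \<open>Losing the element shared with \<open>s\<close> leaves \<open>s'\<close>
          at most one, which makes it an ear.\<close>
        have "card (R s' \<inter> (X - R s)) < card (R s' \<inter> X)"
          by (rule psubset_card_mono) (use fin meet(6) in auto)
        then have "ear R (S - {s}) (X - R s) s'"
          by (intro ear_if_small) (use meet ne fin in auto)
        then have "acyclic_after R (S - {s}) (X - R s) w"
          using acyclic_after_remove_source[OF w(1)] meet(3) ne by blast
        then show ?thesis using acyclic_after_choose[OF _ meet(2) fin(1)] w(2) c card_choose[of s] meet(4)
          by (intro exI[of _ "Suc w"]) auto
      next
        case apart
        obtain y z where yz: "R s \<inter> X = {y, z}" "y \<noteq> z" using apart(3) by (auto simp: card_2_iff)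
        obtain t where t: "t \<in> S - {s}" "y \<in> R t" using irrs(1)[OF apart(2), of y] yz by blast
        obtain u where u: "u \<in> S - {s}" "z \<in> R u" using irrs(1)[OF apart(2), of z] yz by blast
        \<comment> \<open>Otherwise \<open>t\<close> would dominate \<open>s\<close>; hence the
          neighbours at \<open>y\<close> and at \<open>z\<close> are different sources.\<close>
        have zt: "z \<notin> R t" using irrs(3)[OF apart(2) t(1)] yz(1) t(2) by simp
        have tu: "t \<noteq> u" using zt u(2) by blast
        have t2: "card (R t \<inter> X) = 2" using apart(4)[of s t] apart(2,3) t yz(1) by blast
        have u2: "card (R u \<inter> X) = 2" using apart(4)[of s u] apart(2,3) u yz(1) by blast
        \<comment> \<open>The second element of \<open>t\<close> survives the choice of
          \<open>s\<close>; the credit is sought there.\<close>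
        obtain y' where y': "y' \<in> R t \<inter> X" "y' \<noteq> y" "y' \<noteq> z"
        proof -
          have "R t \<inter> X \<noteq> {y}" using t2 by auto
          then show ?thesis using that t(2) yz(1) zt by blast
        qed
        \<comment> \<open>Again five vertices go: the chosen \<open>s\<close>, its two elements, and
          the neighbours \<open>t\<close> and \<open>u\<close>.\<close>
        define S' X' where "S' = S - {s} - {t} - {u}" and "X' = X - R s"
        have c: "card S' + 3 = card S"
          using card_Suc_Diff1[OF fin(1) apart(2)] card_Suc_Diff1[of "S - {s}" t]
            card_Suc_Diff1[of "S - {s} - {t}" u] t u tu fin unfolding S'_def by simp
        have cX: "card X' + 2 = card X" using card_choose[of s] apart(3) by (simp add: X'_def)
        have y'X: "y' \<in> X'" using y' yz(1) by (auto simp: X'_def)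
        \<comment> \<open>Either a third source at \<open>y'\<close> keeps size at most two, or \<open>y'\<close> itself can be reduced away.\<close>
        have cr: "credit R S' X'"
        proof (cases "\<exists>r\<in>S'. y' \<in> R r")
          case True
          then obtain r where r: "r \<in> S'" "y' \<in> R r" by blast
          have "card (R r \<inter> X) = 2"
            by (rule apart(4)[of t r]) (use r t t2 y' in \<open>auto simp: S'_def\<close>)
          moreover have le: "card (R q \<inter> X') \<le> card (R q \<inter> X)" for q
            by (rule card_mono) (use fin in \<open>auto simp: X'_def\<close>)
          moreover have "card (R q \<inter> X') \<le> 3" if "q \<in> S'" for q
            using le[of q] apart(1)[of q] that by (auto simp: S'_def)
          ultimately show ?thesis using r(1) unfolding credit_def by metis
        next
          case False
          then have "reducible R S' X'" using y'X unfolding reducible_def by blast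
          then show ?thesis by (simp add: credit_def)
        qed
        have "S' \<subseteq> S" "X' \<subseteq> X" by (auto simp: S'_def X'_def)
        then obtain w where w: "acyclic_after R S' X' w" "5 * w + 1 \<le> card S' + card X'"
          using ih[of S' X'] c cX cr by auto
        \<comment> \<open>\<open>t\<close> loses \<open>y\<close> and \<open>u\<close> loses
          \<open>z\<close>, so each keeps at most one element and is removed as an ear.\<close>
        have "card (R t \<inter> X') < card (R t \<inter> X)" "card (R u \<inter> X') < card (R u \<inter> X)"
          by (rule psubset_card_mono; use fin t u yz in \<open>auto simp: X'_def\<close>)+
        then have small: "card (R t \<inter> X') \<le> 1" "card (R u \<inter> X') \<le> 1" using t2 u2 by auto
        have finX': "finite X'" using fin by (simp add: X'_def)
        have "acyclic_after R (S - {s} - {t}) X' w"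
          by (rule acyclic_after_remove_source[of _ _ u])
            (use w(1) u tu small finX' in \<open>auto simp: S'_def intro!: ear_if_small\<close>)
        then have "acyclic_after R (S - {s}) X' w"
          by (rule acyclic_after_remove_source) (use t small finX' in \<open>auto intro!: ear_if_small\<close>)
        then have "acyclic_after R S X (Suc w)"
          using acyclic_after_choose[OF _ apart(2) fin(1)] by (simp add: X'_def)
        then show ?thesis using w(2) c cX by (intro exI[of _ "Suc w"]) auto
      qed
    qed
  qed
qed

section \<open>From a join tree to a DAG tree decomposition\<close>

lemma reach_source_iff:
  assumes "v \<in> sources V E"
  shows "v \<in> reach E s \<longleftrightarrow> v = s"
  using assms by (auto simp: reach_def sources_def elim: rtranclE)

lemma reach_subset:
  assumes "is_dag V E" "s \<in> V"
  shows "reach E s \<subseteq> V"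
proof
  fix v assume "v \<in> reach E s"
  then have "(s, v) \<in> E\<^sup>*" by (simp add: reach_def)
  then show "v \<in> V"
    by (induction rule: rtrancl_induct) (use assms in \<open>auto simp: is_dag_def\<close>)
qed

text \<open>Each bag is \<open>B\<close> plus the source of its node. Vertices reached from
  \<open>B\<close> are reached from every bag, sources are reached only from themselves, and the
  join tree handles all other vertices.\<close>

lemma dtw_le_if_acyclic_after:
  assumes dag: "is_dag V E" and F: "acyclic_after (reach E) (sources V E) (V - sources V E) w"
  shows "dtw V E \<le> w + 1"
proof -
  let ?S = "sources V E"
  have finS: "finite ?S" using dag by (auto simp: is_dag_def sources_def)
  obtain B where B: "B \<subseteq> ?S" "card B \<le> w"
    and J: "join_tree (reach E) (?S - B) (V - ?S - \<Union>(reach E ` B))"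
    using F unfolding acyclic_after_def by blast
  have finB: "finite B" using B(1) finS finite_subset by blast
  have "\<exists>T TE bag. dag_tree_decomp V E T TE bag \<and> (\<forall>t\<in>T. card (bag t) \<le> w + 1)"
  proof (cases "?S - B = {}")
    case True
    \<comment> \<open>All sources are chosen, so a single bag suffices.\<close>
    then have "dag_tree_decomp V E {0} {} (\<lambda>_. B)"
      using B(1) is_tree_singleton[of 0] unfolding dag_tree_decomp_def by auto
    then show ?thesis using B(2) by fastforce
  next
    case False
    then obtain T TE b where T: "is_tree T TE" "inj_on b T" "b ` T = ?S - B"
      and con: "connected_bags T TE (\<lambda>t. reach E (b t) \<inter> (V - ?S - \<Union>(reach E ` B)))"
      using J unfolding join_tree_def by auto
    have "dag_tree_decomp V E T TE (\<lambda>t. insert (b t) B)"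
      unfolding dag_tree_decomp_def
    proof (intro conjI ballI allI impI subsetI)
      show "is_tree T TE" by (rule T)
      show "v \<in> ?S" if "t \<in> T" "v \<in> insert (b t) B" for t v using that T(3) B(1) by blast
      show "\<exists>t\<in>T. v \<in> insert (b t) B" if "v \<in> ?S" for v
      proof (cases "v \<in> B")
        case True
        moreover obtain t where "t \<in> T" using T(3) False by blast
        ultimately show ?thesis by blast
      next
        case False
        then have "v \<in> b ` T" using that T(3) by blast
        then show ?thesis by blast
      qed
      fix t1 t2 p t v
      assume t: "t1 \<in> T" "t2 \<in> T" "simple_path T TE p t1 t2" "t \<in> set p"
        and v: "v \<in> reach_set E (insert (b t1) B) \<inter> reach_set E (insert (b t2) B)"
      show "v \<in> reach_set E (insert (b t) B)"
      proof (cases "v \<in> \<Union>(reach E ` B)")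
        case True
        then show ?thesis by (auto simp: reach_set_def)
      next
        case vB: False
        then have v12: "v \<in> reach E (b t1)" "v \<in> reach E (b t2)" using v by (auto simp: reach_set_def)
        show ?thesis
        proof (cases "v \<in> ?S")
          case True
          \<comment> \<open>A source reached from both ends must be the source at both, so by
            injectivity the path is a single node.\<close>
          then have "b t1 = b t2" using v12 reach_source_iff by metis
          then have "t1 = t2" using T(2) t by (auto simp: inj_on_def)
          then show ?thesis using t v by (auto simp: simple_path_refl_iff)
        next
          case False
          have "b t1 \<in> V" using T(3) t(1) by (auto simp: sources_def)
          then have "v \<in> V" using reach_subset[OF dag] v12 by blast
          then have "v \<in> reach E (b t)"
            using con t v12 vB False unfolding connected_bags_def by blast
          then show ?thesis by (auto simp: reach_set_def)
        qed
      qed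
    qed
    moreover have "card (insert (b t) B) \<le> w + 1" for t
      using B(2) card_insert_le_m1[of "w + 1" B "b t"] by simp
    ultimately show ?thesis by blast
  qed
  then obtain T TE bag where D: "dag_tree_decomp V E T TE bag" "\<forall>t\<in>T. card (bag t) \<le> w + 1"
    by blast
  have "finite T" "T \<noteq> {}" using D(1) by (auto simp: dag_tree_decomp_def is_tree_def)
  then have "dtd_width T bag \<le> w + 1" using D(2) by (simp add: dtd_width_def)
  moreover have "dtw V E \<le> dtd_width T bag"
    unfolding dtw_def by (rule Least_le) (use D(1) in blast)
  ultimately show ?thesis by linarith
qed

theorem mainTheorem19:
  fixes V :: "'a set" and E :: "('a \<times> 'a) set" and k :: nat
  assumes "is_dag V E" and "card V = k"
  shows "real (dtw V E) \<le> real k / 5 + 4"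
proof -
  let ?S = "sources V E"
  have fin: "finite V" and sub: "?S \<subseteq> V" using assms(1) by (auto simp: is_dag_def sources_def)
  obtain w where w: "acyclic_after (reach E) ?S (V - ?S) w" "5 * w \<le> card ?S + card (V - ?S)"
    using acyclic_after_fifth[of ?S "V - ?S" "reach E"] fin finite_subset[OF sub] by auto
  have "card ?S + card (V - ?S) = k"
    using assms(2) fin sub by (metis card_Diff_subset card_mono finite_subset le_add_diff_inverse)
  \<comment> \<open>From \<open>5 * w \<le> k\<close> the width is at most \<open>k / 5 + 1\<close>,
    within the claimed bound.\<close>
  then show ?thesis using w(2) dtw_le_if_acyclic_after[OF assms(1) w(1)] by simp
qed

end
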